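(* For all integers $n\ge 1$ and $0\le k\le n^2$, the $q$-Mahonian number of type $B$ is the generating function of the partitions into $k$ parts in which each part $j$ is used at most $2j-1$ times and the largest part is at most $n$; that is, $$i_{B_q}(n,k)=\sum_{\lambda\in\mathcal{P}r_{n,k}}q^{|\lambda|}.$$
   Context: $B_n$ is the hyperoctahedral group: the group of bijections $\pi$ of $\{-n,\ldots,-1,1,\ldots,n\}$ with $\pi(-j)=-\pi(j)$ for all $j\in\{1,\dots,n\}$. Every $\pi\in B_n$ is written uniquely as $\pi(p)=(-1)^{r_p}\sigma_p$ for $1\le p\le n$, with $r_p\in\{0,1\}$ and $\sigma=\sigma_1\cdots\sigma_n$ a permutation of $\{1,\dots,n\}$. For $1\le i\le n$ put $m=n+1-i$ and $inv_i(\sigma)=|\{j: j<m,\ \sigma_j>\sigma_m\}|$, and define $inv_i(\pi)=inv_i(\sigma)$ if $r_m=0$, and $inv_i(\pi)=1+2|\{j: j<m,\ \sigma_j<\sigma_m\}|+inv_i(\sigma)$ if $r_m=1$. Put $inv_B(\pi)=\sum_{i=1}^n inv_i(\pi)$, $I_B(n,k)=\{\pi\in B_n: inv_B(\pi)=k\}$ and $\omega(\pi)=\sum_{i=1}^n(n-i+1)\,inv_i(\pi)$. With $q$ an indeterminate, the $q$-Mahonian number of type $B$ is $i_{B_q}(n,k)=\sum_{\pi\in I_B(n,k)}q^{\omega(\pi)}$. $\mathcal{P}r_{n,k}$ is the set of integer partitions $\lambda=(\lambda_1\ge\cdots\ge\lambda_k\ge 1)$ into exactly $k$ parts, with largest part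 at most $n$, such that each part $j$ occurs at most $2j-1$ times (for $k=0$, only the empty partition), and $|\lambda|=\sum_{j=1}^k\lambda_j$. *)

theory Defs
  imports "HOL-Combinatorics.Permutations" "HOL-Computational_Algebra.Polynomial"
begin

definition signed_set :: "nat \<Rightarrow> int set" where
  "signed_set n = {- int n..- 1} \<union> {1..int n}"

text \<open>Elements of the hyperoctahedral group are total functions on the integers. By
  \<^const>\<open>permutes\<close> they are the identity outside the signed set, so each group element
  has exactly one representative.\<close>

definition hyperoctahedral :: "nat \<Rightarrow> (int \<Rightarrow> int) set" where
  "hyperoctahedral n =
     {\<pi>. \<pi> permutes signed_set n \<and> (\<forall>j\<in>{1..int n}. \<pi> (- j) = - \<pi> j)}"

definition sign_exp :: "(int \<Rightarrow> int) \<Rightarrow> nat \<Rightarrow> nat" where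
  "sign_exp \<pi> p = (if \<pi> (int p) < 0 then 1 else 0)"

definition abs_word :: "(int \<Rightarrow> int) \<Rightarrow> nat \<Rightarrow> nat" where
  "abs_word \<pi> p = nat \<bar>\<pi> (int p)\<bar>"

definition inv_perm :: "nat \<Rightarrow> (nat \<Rightarrow> nat) \<Rightarrow> nat \<Rightarrow> nat" where
  "inv_perm n \<sigma> i = (let m = n + 1 - i in card {j. 1 \<le> j \<and> j < m \<and> \<sigma> j > \<sigma> m})"

definition inv_signed :: "nat \<Rightarrow> (int \<Rightarrow> int) \<Rightarrow> nat \<Rightarrow> nat" where
  "inv_signed n \<pi> i =
     (let m = n + 1 - i; \<sigma> = abs_word \<pi> in
        if sign_exp \<pi> m = 0 then inv_perm n \<sigma> i
        else 1 + 2 * card {j. 1 \<le> j \<and> j < m \<and> \<sigma> j < \<sigma> m} + inv_perm n \<sigma> i)"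

definition inv_B :: "nat \<Rightarrow> (int \<Rightarrow> int) \<Rightarrow> nat" where
  "inv_B n \<pi> = (\<Sum>i=1..n. inv_signed n \<pi> i)"

definition I_B :: "nat \<Rightarrow> nat \<Rightarrow> (int \<Rightarrow> int) set" where
  "I_B n k = {\<pi> \<in> hyperoctahedral n. inv_B n \<pi> = k}"

definition weight :: "nat \<Rightarrow> (int \<Rightarrow> int) \<Rightarrow> nat" where
  "weight n \<pi> = (\<Sum>i=1..n. (n - i + 1) * inv_signed n \<pi> i)"

definition q_mahonian_B :: "nat \<Rightarrow> nat \<Rightarrow> int poly" where
  "q_mahonian_B n k = (\<Sum>\<pi>\<in>I_B n k. monom 1 (weight n \<pi>))"

definition restricted_partitions :: "nat \<Rightarrow> nat \<Rightarrow> nat list set" where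
  "restricted_partitions n k =
     {xs. sorted_wrt (\<ge>) xs \<and> length xs = k \<and> set xs \<subseteq> {1..n} \<and>
          (\<forall>j\<in>{1..n}. count_list xs j \<le> 2 * j - 1)}"

lemma signed_set_iff: "x \<in> signed_set n \<longleftrightarrow> x \<noteq> 0 \<and> \<bar>x\<bar> \<le> int n"
  by (auto simp: signed_set_def)

lemma signed_word: "\<pi> (int p) = (- 1) ^ sign_exp \<pi> p * int (abs_word \<pi> p)"
  by (simp add: sign_exp_def abs_word_def)

lemma abs_word_bij_betw:
  assumes "\<pi> \<in> hyperoctahedral n"
  shows "bij_betw (abs_word \<pi>) {1..n} {1..n}"
proof -
  have perm: "\<pi> permutes signed_set n"
    and odd: "\<And>j. j \<in> {1..int n} \<Longrightarrow> \<pi> (- j) = - \<pi> j"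
    using assms by (auto simp: hyperoctahedral_def)
  have inj: "x = y" if "\<pi> x = \<pi> y" for x y
    using permutes_inj[OF perm] that by (auto dest: injD)
  have "inj_on (abs_word \<pi>) {1..n}"
  proof (rule inj_onI)
    fix x y assume x: "x \<in> {1..n}" and y: "y \<in> {1..n}" and "abs_word \<pi> x = abs_word \<pi> y"
    then have "\<pi> (int x) = \<pi> (int y) \<or> \<pi> (int x) = - \<pi> (int y)"
      by (auto simp: abs_word_def)
    then have "\<pi> (int x) = \<pi> (int y) \<or> \<pi> (int x) = \<pi> (- int y)"
      using odd[of "int y"] y by auto
    then show "x = y"
      using inj x y by force
  qed
  moreover have "abs_word \<pi> ` {1..n} \<subseteq> {1..n}"
  proof
    fix y assume "y \<in> abs_word \<pi> ` {1..n}"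
    then obtain x where x: "x \<in> {1..n}" "y = abs_word \<pi> x" by auto
    then have "\<pi> (int x) \<in> signed_set n"
      using permutes_in_image[OF perm, of "int x"] by (auto simp: signed_set_iff)
    then show "y \<in> {1..n}"
      using x by (auto simp: signed_set_iff abs_word_def)
  qed
  ultimately show ?thesis
    by (simp add: bij_betw_def endo_inj_surj)
qed

lemma finite_I_B: "finite (I_B n k)"
proof (rule finite_subset)
  show "I_B n k \<subseteq> {\<pi>. \<pi> permutes signed_set n}"
    by (auto simp: I_B_def hyperoctahedral_def)
  show "finite {\<pi>. \<pi> permutes signed_set n}"
    by (rule finite_permutations) (simp add: signed_set_def)
qed

lemma finite_restricted_partitions: "finite (restricted_partitions n k)"
  by (rule finite_subset[OF _ finite_lists_length_eq[of "{1..n}" k]])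
     (auto simp: restricted_partitions_def)

end

theory Submission
  imports Defs "HOL-Library.Multiset"
begin

text \<open>Index everything by the position \<open>m\<close> instead of \<open>i = n + 1 - m\<close>, and write \<open>c m\<close> for
  the inversion number at position \<open>m\<close>. Then \<^const>\<open>inv_B\<close> is the sum of the \<open>c m\<close> and
  \<^const>\<open>weight\<close> is the sum of the \<open>m * c m\<close>. These are exactly the length and the size of the
  partition in which the part \<open>m\<close> is repeated \<open>c m\<close> times. Hence it suffices that the code
  \<open>c\<close> of a signed permutation ranges bijectively over all functions with \<open>c m \<le> 2 * m - 1\<close>
  on \<open>{1..n}\<close>, which are the multiplicity functions of restricted partitions.

  Let \<open>l\<close> be the number of earlier letters that exceed the letter at \<open>m\<close> in absolute value.
  The other \<open>m - 1 - l\<close> earlier letters are smaller, so \<open>c m\<close> is \<open>l\<close> for a positive letter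
  and \<open>1 + 2 * (m - 1 - l) + l = 2 * m - 1 - l\<close> for a negative one (\<open>inv_signed_at\<close>). As
  \<open>l < m\<close>, the two cases fill the disjoint halves \<open>{0..<m}\<close> and \<open>{m..<2 * m}\<close> of the allowed
  range, so \<open>c m\<close> gives back both the sign and \<open>l\<close>. The numbers \<open>l\<close> form a Lehmer code and
  determine the underlying permutation (\<open>left_inv_determines\<close>). This makes the code
  injective, and surjectivity follows by counting: there are at least \<open>2 ^ n * n!\<close> signed
  permutations and exactly \<open>2 * 4 * \<dots> * (2 * n) = 2 ^ n * n!\<close> admissible codes.\<close>

section \<open>Lehmer codes of words\<close>

definition left_inv :: "(nat \<Rightarrow> nat) \<Rightarrow> nat \<Rightarrow> nat" where
  "left_inv f m = card {j \<in> {1..<m}. f m < f j}"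

lemma left_inv_less:
  assumes "1 \<le> m"
  shows "left_inv f m < m"
proof -
  have "left_inv f m \<le> card {1..<m}"
    unfolding left_inv_def by (rule card_mono) auto
  with assms show ?thesis by simp
qed

lemma card_less_before:
  assumes "inj_on f {1..m}" and "1 \<le> m"
  shows "card {j \<in> {1..<m}. f j < f m} = m - 1 - left_inv f m"
proof -
  have "f j < f m \<or> f m < f j" if "j \<in> {1..<m}" for j
  proof -
    have "f j \<noteq> f m"
      using inj_onD[OF assms(1), of j m] that by auto
    then show ?thesis by (simp add: neq_iff)
  qed
  then have "{1..<m} = {j \<in> {1..<m}. f j < f m} \<union> {j \<in> {1..<m}. f m < f j}"
    by blast
  then have "card {1..<m} = card ({j \<in> {1..<m}. f j < f m} \<union> {j \<in> {1..<m}. f m < f j})"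
    by (rule arg_cong)
  also have "\<dots> = card {j \<in> {1..<m}. f j < f m} + left_inv f m"
    unfolding left_inv_def by (rule card_Un_disjoint) auto
  finally show ?thesis by simp
qed

text \<open>An injective word does not repeat a letter, so counting positions before the last is
  counting letters. The order of the earlier letters disappears: what remains is the rank from
  above of the last letter in the set of all letters.\<close>

lemma left_inv_last:
  assumes "inj_on f {1..Suc n}"
  shows "left_inv f (Suc n) = card {x \<in> f ` {1..Suc n}. f (Suc n) < x}"
proof -
  have "{x \<in> f ` {1..Suc n}. f (Suc n) < x} = f ` {j \<in> {1..<Suc n}. f (Suc n) < f j}"
    by (auto simp: le_Suc_eq)
  moreover have "inj_on f {j \<in> {1..<Suc n}. f (Suc n) < f j}"
    by (rule inj_on_subset[OF assms]) auto
  ultimately show ?thesis by (simp add: left_inv_def card_image)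
qed

lemma eq_if_card_greater_eq:
  fixes a b :: "'a :: linorder"
  assumes "finite S" "a \<in> S" "b \<in> S"
    and "card {x \<in> S. a < x} = card {x \<in> S. b < x}"
  shows "a = b"
proof -
  have strict: "card {x \<in> S. v < x} < card {x \<in> S. u < x}" if "u < v" "v \<in> S" for u v
    by (rule psubset_card_mono) (use that assms(1) in auto)
  show ?thesis
    using strict[of a b] strict[of b a] assms by (cases a b rule: linorder_cases) auto
qed

text \<open>Decoding proceeds from the right: the set of letters and the last rank determine the
  last letter, hence also the set of the remaining letters. In this way
  equality of the sets of letters passes from \<open>Suc n\<close> to \<open>n\<close>.\<close>

lemma left_inv_determines:
  assumes "inj_on f {1..n}" "inj_on g {1..n}" "f ` {1..n} = g ` {1..n}"
    and "\<And>m. m \<in> {1..n} \<Longrightarrow> left_inv f m = left_inv g m"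
    and "m \<in> {1..n}"
  shows "f m = g m"
  using assms
proof (induction n arbitrary: m)
  case 0
  then show ?case by simp
next
  case (Suc n)
  have last: "f (Suc n) = g (Suc n)"
  proof (rule eq_if_card_greater_eq)
    show "card {x \<in> f ` {1..Suc n}. f (Suc n) < x} = card {x \<in> f ` {1..Suc n}. g (Suc n) < x}"
      using left_inv_last[OF Suc.prems(1)] left_inv_last[OF Suc.prems(2)] Suc.prems(3)
        Suc.prems(4)[of "Suc n"] by simp
    show "g (Suc n) \<in> f ` {1..Suc n}"
      unfolding Suc.prems(3) by simp
  qed auto
  have image: "h ` {1..n} = h ` {1..Suc n} - {h (Suc n)}" if "inj_on h {1..Suc n}" for h :: "nat \<Rightarrow> nat"
  proof -
    have "{1..n} = {1..Suc n} - {Suc n}" by auto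
    then show ?thesis
      using inj_on_image_set_diff[OF that, of "{1..Suc n}" "{Suc n}"] by simp
  qed
  show ?case
  proof (cases "m = Suc n")
    case True
    with last show ?thesis by simp
  next
    case False
    show ?thesis
    proof (rule Suc.IH)
      show "inj_on f {1..n}" "inj_on g {1..n}"
        by (rule inj_on_subset[OF Suc.prems(1)] inj_on_subset[OF Suc.prems(2)]; auto)+
      show "f ` {1..n} = g ` {1..n}"
        unfolding image[OF Suc.prems(1)] image[OF Suc.prems(2)] Suc.prems(3) last ..
      show "m \<in> {1..n}" using Suc.prems(5) False by auto
      show "left_inv f m = left_inv g m" if "m \<in> {1..n}" for m
        using Suc.prems(4) that by auto
    qed
  qed
qed

section \<open>The code of a signed permutation\<close>

lemma inv_signed_at:
  assumes "\<pi> \<in> hyperoctahedral n" and m: "m \<in> {1..n}"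
  shows "inv_signed n \<pi> (n + 1 - m) =
    (if sign_exp \<pi> m = 0 then left_inv (abs_word \<pi>) m
     else 2 * m - 1 - left_inv (abs_word \<pi>) m)"
proof -
  have pos: "n + 1 - (n + 1 - m) = m" using m by auto
  have inv: "inv_perm n (abs_word \<pi>) (n + 1 - m) = left_inv (abs_word \<pi>) m"
    unfolding inv_perm_def left_inv_def pos Let_def by (rule arg_cong[of _ _ card]) auto
  have "inj_on (abs_word \<pi>) {1..m}"
    using abs_word_bij_betw[OF assms(1)] m by (auto simp: bij_betw_def elim!: inj_on_subset)
  then have "card {j \<in> {1..<m}. abs_word \<pi> j < abs_word \<pi> m} = m - 1 - left_inv (abs_word \<pi>) m"
    using m by (intro card_less_before) auto
  moreover have "{j. 1 \<le> j \<and> j < m \<and> abs_word \<pi> j < abs_word \<pi> m}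
      = {j \<in> {1..<m}. abs_word \<pi> j < abs_word \<pi> m}" by auto
  ultimately have "card {j. 1 \<le> j \<and> j < m \<and> abs_word \<pi> j < abs_word \<pi> m}
      = m - 1 - left_inv (abs_word \<pi>) m" by simp
  then show ?thesis
    using left_inv_less[of m "abs_word \<pi>"] m inv
    unfolding inv_signed_def Let_def pos by auto
qed

definition code :: "nat \<Rightarrow> (int \<Rightarrow> int) \<Rightarrow> nat \<Rightarrow> nat" where
  "code n \<pi> = (\<lambda>m\<in>{1..n}. inv_signed n \<pi> (n + 1 - m))"

definition codes :: "nat \<Rightarrow> (nat \<Rightarrow> nat) set" where
  "codes n = (\<Pi>\<^sub>E m\<in>{1..n}. {..2 * m - 1})"

lemma finite_codes: "finite (codes n)"
  unfolding codes_def by (intro finite_PiE) auto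

lemma card_codes: "card (codes n) = 2 ^ n * fact n"
proof -
  have "card (codes n) = (\<Prod>m\<in>{1..n}. 2 * m)"
    unfolding codes_def by (subst card_PiE) (auto intro!: prod.cong)
  also have "\<dots> = 2 ^ n * fact n"
    by (simp add: prod.distrib fact_prod)
  finally show ?thesis .
qed

lemma code_in_codes:
  assumes "\<pi> \<in> hyperoctahedral n"
  shows "code n \<pi> \<in> codes n"
proof -
  have "inv_signed n \<pi> (n + 1 - m) \<le> 2 * m - 1" if m: "m \<in> {1..n}" for m
    using inv_signed_at[OF assms m] left_inv_less[of m "abs_word \<pi>"] m by auto
  then show ?thesis by (auto simp: codes_def code_def)
qed

lemma hyperoctahedral_eqI:
  assumes \<pi>: "\<pi> \<in> hyperoctahedral n" and \<rho>: "\<rho> \<in> hyperoctahedral n"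
    and "\<And>m. m \<in> {1..n} \<Longrightarrow> sign_exp \<pi> m = sign_exp \<rho> m"
    and "\<And>m. m \<in> {1..n} \<Longrightarrow> abs_word \<pi> m = abs_word \<rho> m"
  shows "\<pi> = \<rho>"
proof
  fix j
  have pos: "\<pi> i = \<rho> i" if "i \<in> {1..int n}" for i
  proof -
    from that have "nat i \<in> {1..n}" and i: "i = int (nat i)" by auto
    then show ?thesis
      using assms(3,4) signed_word[of \<pi> "nat i"] signed_word[of \<rho> "nat i"] by metis
  qed
  consider "j \<notin> signed_set n" | "j \<in> {1..int n}" | "- j \<in> {1..int n}"
    unfolding signed_set_iff atLeastAtMost_iff by linarith
  then show "\<pi> j = \<rho> j"
  proof cases
    case 1
    with \<pi> \<rho> have "\<pi> j = j" "\<rho> j = j"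
      by (auto simp: hyperoctahedral_def intro: permutes_not_in)
    then show ?thesis by simp
  next
    case 2
    with pos show ?thesis by blast
  next
    case 3
    with \<pi> \<rho> have "\<pi> (- (- j)) = - \<pi> (- j)" "\<rho> (- (- j)) = - \<rho> (- j)"
      unfolding hyperoctahedral_def by blast+
    with pos[OF 3] show ?thesis by simp
  qed
qed

lemma inj_on_code: "inj_on (code n) (hyperoctahedral n)"
proof (rule inj_onI)
  fix \<pi> \<rho>
  assume \<pi>: "\<pi> \<in> hyperoctahedral n" and \<rho>: "\<rho> \<in> hyperoctahedral n"
    and eq: "code n \<pi> = code n \<rho>"
  \<comment> \<open>The sign at \<open>m\<close> is negative exactly if the code at \<open>m\<close> is at least \<open>m\<close>.\<close>
  have parts: "sign_exp \<pi> m = sign_exp \<rho> m"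
      "left_inv (abs_word \<pi>) m = left_inv (abs_word \<rho>) m" if m: "m \<in> {1..n}" for m
  proof -
    have "inv_signed n \<pi> (n + 1 - m) = inv_signed n \<rho> (n + 1 - m)"
      using fun_cong[OF eq, of m] m by (simp add: code_def)
    then show "sign_exp \<pi> m = sign_exp \<rho> m"
        "left_inv (abs_word \<pi>) m = left_inv (abs_word \<rho>) m"
      unfolding inv_signed_at[OF \<pi> m] inv_signed_at[OF \<rho> m]
      using left_inv_less[of m "abs_word \<pi>"] left_inv_less[of m "abs_word \<rho>"] m
      by (auto simp: sign_exp_def split: if_splits)
  qed
  show "\<pi> = \<rho>"
  proof (rule hyperoctahedral_eqI[OF \<pi> \<rho> parts(1)])
    show "abs_word \<pi> m = abs_word \<rho> m" if "m \<in> {1..n}" for m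
      using abs_word_bij_betw[OF \<pi>] abs_word_bij_betw[OF \<rho>]
      by (intro left_inv_determines[OF _ _ _ parts(2) that]) (simp_all add: bij_betw_def)
  qed
qed

section \<open>Counting signed permutations\<close>

text \<open>The factor \<^term>\<open>sgn j\<close> makes the function odd; on \<open>{1..n}\<close> its absolute
  values are those of \<open>\<sigma>\<close> and it is negative exactly on \<open>A\<close>.\<close>

definition signed_perm :: "(nat \<Rightarrow> nat) \<Rightarrow> nat set \<Rightarrow> int \<Rightarrow> int" where
  "signed_perm \<sigma> A j = sgn j * (if nat \<bar>j\<bar> \<in> A then - 1 else 1) * int (\<sigma> (nat \<bar>j\<bar>))"

lemma signed_perm_in_hyperoctahedral:
  assumes \<sigma>: "\<sigma> permutes {1..n}" and A: "A \<subseteq> {1..n}"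
  shows "signed_perm \<sigma> A \<in> hyperoctahedral n"
proof -
  have range: "\<sigma> p \<in> {1..n} \<longleftrightarrow> p \<in> {1..n}" for p
    using permutes_in_image[OF \<sigma>] .
  have "signed_perm \<sigma> A permutes signed_set n"
  proof (rule bij_imp_permutes)
    have maps: "signed_perm \<sigma> A ` signed_set n \<subseteq> signed_set n"
    proof
      fix y assume "y \<in> signed_perm \<sigma> A ` signed_set n"
      then obtain j where j: "j \<noteq> 0" "\<bar>j\<bar> \<le> int n" and y: "y = signed_perm \<sigma> A j"
        by (auto simp: signed_set_iff)
      then have "\<sigma> (nat \<bar>j\<bar>) \<in> {1..n}" unfolding range by auto
      with j show "y \<in> signed_set n"
        by (auto simp: y signed_set_iff signed_perm_def abs_mult abs_sgn_eq sgn_0_0)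
    qed
    moreover have "inj_on (signed_perm \<sigma> A) (signed_set n)"
    proof (rule inj_onI)
      fix i j
      assume i: "i \<in> signed_set n" and j: "j \<in> signed_set n"
        and eq: "signed_perm \<sigma> A i = signed_perm \<sigma> A j"
      have nz: "i \<noteq> 0" "j \<noteq> 0" using i j by (auto simp: signed_set_iff)
      have "\<bar>signed_perm \<sigma> A l\<bar> = int (\<sigma> (nat \<bar>l\<bar>))" if "l \<noteq> 0" for l
        using that by (simp add: signed_perm_def abs_mult abs_sgn_eq)
      with eq nz have "\<sigma> (nat \<bar>i\<bar>) = \<sigma> (nat \<bar>j\<bar>)" by (metis of_nat_eq_iff)
      then have "nat \<bar>i\<bar> = nat \<bar>j\<bar>"
        using permutes_inj[OF \<sigma>] by (auto dest: injD)
      then have abs: "\<bar>i\<bar> = \<bar>j\<bar>" by simp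
      have "\<sigma> (nat \<bar>j\<bar>) \<noteq> 0"
        using range[of "nat \<bar>j\<bar>"] j by (auto simp: signed_set_iff)
      with eq abs have "sgn i = sgn j" by (auto simp: signed_perm_def split: if_splits)
      with abs show "i = j" by (metis sgn_mult_abs)
    qed
    ultimately show "bij_betw (signed_perm \<sigma> A) (signed_set n) (signed_set n)"
      by (simp add: bij_betw_def endo_inj_surj signed_set_def)
    show "signed_perm \<sigma> A j = j" if "j \<notin> signed_set n" for j
    proof (cases "j = 0")
      case False
      with that have "nat \<bar>j\<bar> \<notin> {1..n}" by (auto simp: signed_set_iff)
      with A show ?thesis
        by (auto simp: signed_perm_def permutes_not_in[OF \<sigma>] sgn_mult_abs)
    qed (simp add: signed_perm_def)
  qed
  then show ?thesis by (auto simp: hyperoctahedral_def signed_perm_def)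
qed

lemma card_hyperoctahedral_ge: "2 ^ n * fact n \<le> card (hyperoctahedral n)"
proof -
  let ?D = "{\<sigma>. \<sigma> permutes {1..n}} \<times> Pow {1..n}"
  have inj: "inj_on (\<lambda>(\<sigma>, A). signed_perm \<sigma> A) ?D"
  proof (rule inj_onI, clarify)
    fix \<sigma> \<tau> A B
    assume \<sigma>: "\<sigma> permutes {1..n}" and \<tau>: "\<tau> permutes {1..n}"
      and A: "A \<subseteq> {1..n}" and B: "B \<subseteq> {1..n}"
      and eq: "signed_perm \<sigma> A = signed_perm \<tau> B"
    have nz: "\<sigma> p \<noteq> 0 \<and> \<tau> p \<noteq> 0" if "p \<in> {1..n}" for p
      using that permutes_in_image[OF \<sigma>, of p] permutes_in_image[OF \<tau>, of p] by auto
    have at: "\<sigma> p = \<tau> p \<and> (p \<in> A \<longleftrightarrow> p \<in> B)" if p: "p \<in> {1..n}" for p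
      using fun_cong[OF eq, of "int p"] nz[OF p] p
      by (auto simp: signed_perm_def split: if_splits)
    have "\<sigma> p = \<tau> p" for p
      using at[of p] permutes_not_in[OF \<sigma>, of p] permutes_not_in[OF \<tau>, of p]
      by (cases "p \<in> {1..n}") auto
    moreover have "A = B" using at A B by blast
    ultimately show "\<sigma> = \<tau> \<and> A = B" by blast
  qed
  have "finite (hyperoctahedral n)"
    by (rule finite_subset[OF _ finite_permutations[of "signed_set n"]])
       (auto simp: hyperoctahedral_def signed_set_def)
  then have "card ?D \<le> card (hyperoctahedral n)"
    by (rule card_inj_on_le[OF inj _, rotated]) (auto intro!: signed_perm_in_hyperoctahedral simp del: One_nat_def)
  moreover have "card ?D = fact n * 2 ^ n"
    by (simp add: card_cartesian_product card_permutations[OF refl] card_Pow)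
  ultimately show ?thesis by (simp add: mult.commute)
qed

lemma bij_betw_code: "bij_betw (code n) (hyperoctahedral n) (codes n)"
proof -
  have sub: "code n ` hyperoctahedral n \<subseteq> codes n"
    by (auto intro: code_in_codes)
  have "card (codes n) \<le> card (code n ` hyperoctahedral n)"
    using card_hyperoctahedral_ge[of n] by (simp add: card_codes card_image[OF inj_on_code])
  then have "code n ` hyperoctahedral n = codes n"
    by (rule card_seteq[OF finite_codes sub])
  then show ?thesis by (simp add: bij_betw_def inj_on_code)
qed

lemma inv_B_eq_sum_code: "inv_B n \<pi> = (\<Sum>m=1..n. code n \<pi> m)"
  unfolding inv_B_def
  by (subst sum.atLeastAtMost_rev) (auto intro!: sum.cong simp: code_def)

lemma weight_eq_sum_code: "weight n \<pi> = (\<Sum>m=1..n. m * code n \<pi> m)"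
  unfolding weight_def
  by (subst sum.atLeastAtMost_rev) (auto intro!: sum.cong simp: code_def)

section \<open>Multiplicity functions of partitions\<close>

definition multiplicities :: "nat \<Rightarrow> nat list \<Rightarrow> nat \<Rightarrow> nat" where
  "multiplicities n xs = (\<lambda>m\<in>{1..n}. count_list xs m)"

lemma length_eq_sum_multiplicities:
  assumes "set xs \<subseteq> {1..n}"
  shows "length xs = (\<Sum>m=1..n. multiplicities n xs m)"
proof -
  have "sum (count_list xs) {1..n} = length xs"
    by (rule sum_count_set) (use assms in auto)
  then show ?thesis by (simp add: multiplicities_def)
qed

lemma sum_list_eq_sum_multiplicities:
  assumes "set xs \<subseteq> {1..n}"
  shows "sum_list xs = (\<Sum>m=1..n. m * multiplicities n xs m)"
  using assms sum_list_map_eq_sum_count2[of xs "{1..n}" "\<lambda>m. m"]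
  by (simp add: multiplicities_def mult.commute)

lemma multiplicities_in_codes:
  assumes "xs \<in> restricted_partitions n k"
  shows "multiplicities n xs \<in> codes n"
  using assms by (auto simp: restricted_partitions_def multiplicities_def codes_def)

lemma bij_betw_multiplicities:
  "bij_betw (multiplicities n) (restricted_partitions n k)
     {c \<in> codes n. (\<Sum>m=1..n. c m) = k}"
  unfolding bij_betw_def
proof
  show "inj_on (multiplicities n) (restricted_partitions n k)"
  proof (rule inj_onI)
    fix xs ys
    assume xs: "xs \<in> restricted_partitions n k" and ys: "ys \<in> restricted_partitions n k"
      and eq: "multiplicities n xs = multiplicities n ys"
    have "count_list xs m = count_list ys m" for m
    proof (cases "m \<in> {1..n}")
      case True
      with fun_cong[OF eq, of m] show ?thesis by (simp add: multiplicities_def)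
    next
      case False
      with xs ys have "m \<notin> set xs" "m \<notin> set ys" by (auto simp: restricted_partitions_def)
      then show ?thesis by (simp add: count_list_0_iff)
    qed
    then have "mset (rev xs) = mset (rev ys)"
      by (intro multiset_eqI) (simp add: count_mset)
    moreover have "sorted (rev xs)" "sorted (rev ys)"
      using xs ys by (auto simp: restricted_partitions_def sorted_wrt_rev)
    ultimately have "rev xs = rev ys"
      by (metis properties_for_sort)
    then show "xs = ys" by simp
  qed
  show "multiplicities n ` restricted_partitions n k = {c \<in> codes n. (\<Sum>m=1..n. c m) = k}"
  proof (rule equalityI)
    show "multiplicities n ` restricted_partitions n k \<subseteq> {c \<in> codes n. (\<Sum>m=1..n. c m) = k}"
    proof clarify
      fix xs assume xs: "xs \<in> restricted_partitions n k"
      then have "length xs = k" "set xs \<subseteq> {1..n}" by (auto simp: restricted_partitions_def)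
      with length_eq_sum_multiplicities[of xs n] multiplicities_in_codes[OF xs]
      show "multiplicities n xs \<in> codes n \<and> (\<Sum>m=1..n. multiplicities n xs m) = k" by simp
    qed
    show "{c \<in> codes n. (\<Sum>m=1..n. c m) = k} \<subseteq> multiplicities n ` restricted_partitions n k"
    proof clarify
      fix c assume c: "c \<in> codes n" and k: "k = (\<Sum>m=1..n. c m)"
      define M where "M = (\<Sum>m\<in>{1..n}. replicate_mset (c m) m)"
      define xs where "xs = rev (sorted_list_of_multiset M)"
      have count_M: "count M m = (if m \<in> {1..n} then c m else 0)" for m
        by (simp add: M_def count_sum if_distrib sum.delta cong: if_cong)
      have count: "count_list xs m = (if m \<in> {1..n} then c m else 0)" for m
        unfolding xs_def by (simp add: count_M flip: count_mset)
      have "m \<in> {1..n}" if "m \<in> set xs" for m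
      proof -
        from that have "count_list xs m \<noteq> 0" by (simp add: count_list_0_iff)
        with count show ?thesis by metis
      qed
      then have set: "set xs \<subseteq> {1..n}" by blast
      have mult: "multiplicities n xs = c"
        using c by (auto simp: multiplicities_def count codes_def fun_eq_iff PiE_def extensional_def)
      have "length xs = k"
        using length_eq_sum_multiplicities[OF set] by (simp add: mult k)
      moreover have "sorted_wrt (\<ge>) xs"
        by (simp add: xs_def sorted_wrt_rev sorted_sorted_list_of_multiset)
      moreover have "count_list xs m \<le> 2 * m - 1" if "m \<in> {1..n}" for m
        using that c by (auto simp: count codes_def)
      ultimately have "xs \<in> restricted_partitions n k"
        using set by (simp add: restricted_partitions_def)
      then show "c \<in> multiplicities n ` restricted_partitions n (\<Sum>m=1..n. c m)"
        using mult k by blast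
    qed
  qed
qed

section \<open>The generating function identity\<close>

theorem proposition4p7:
  fixes n k :: nat
  assumes "n \<ge> 1" and "k \<le> n\<^sup>2"
  shows "q_mahonian_B n k = (\<Sum>xs\<in>restricted_partitions n k. monom (1 :: int) (sum_list xs))"
proof -
  let ?C = "{c \<in> codes n. (\<Sum>m=1..n. c m) = k}"
  let ?w = "\<lambda>c. monom (1 :: int) (\<Sum>m=1..n. m * c m)"
  have bij: "bij_betw (code n) (I_B n k) ?C"
    unfolding I_B_def by (rule bij_betw_Collect[OF bij_betw_code]) (simp add: inv_B_eq_sum_code)
  have "q_mahonian_B n k = (\<Sum>\<pi>\<in>I_B n k. ?w (code n \<pi>))"
    by (simp add: q_mahonian_B_def weight_eq_sum_code)
  also have "\<dots> = (\<Sum>c\<in>?C. ?w c)"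
    by (rule sum.reindex_bij_betw[OF bij])
  also have "\<dots> = (\<Sum>xs\<in>restricted_partitions n k. ?w (multiplicities n xs))"
    by (rule sum.reindex_bij_betw[OF bij_betw_multiplicities, symmetric])
  also have "\<dots> = (\<Sum>xs\<in>restricted_partitions n k. monom 1 (sum_list xs))"
    by (rule sum.cong) (auto simp: restricted_partitions_def sum_list_eq_sum_multiplicities)
  finally show ?thesis .
qed

end
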